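(* Let $n,d$ be positive integers, $\delta\in(0,1)$, and $\sigma$ a $d\times d$ positive semidefinite matrix of trace $1$. Let $\mu_1$ be a probability distribution on pairs $(b,a)\in\{0,1\}^n\times\{0,1\}^n$, and let $\mu_2$ be the distribution of $(b+r,a)$ where $(b,a)\sim\mu_1$ and $r$ is uniform on $\{0,1\}^n$, independent. Let $f_X,f_Z:\{0,1\}^n\to U(\mathbb{C}^d)$ satisfy: $f_X(a)^\dagger=f_X(a)$, $f_Z(b)^\dagger=f_Z(b)$, $f_X(a)^2=f_Z(b)^2=I$ for all $a,b$; $f_X(a)f_X(b)=f_X(a+b)$ and $f_Z(a)f_Z(b)=f_Z(a+b)$ for all $a,b$; and for $j=1,2$, $$\mathbb{E}_{(b,a)\sim\mu_j}\big\|f_Z(b)f_X(a)-(-1)^{a\cdot b}f_X(a)f_Z(b)\big\|_\sigma^2\le\delta.$$ Then there exist a positive integer $d''$ and an isometry $V:\mathbb{C}^d\to\mathbb{C}^{2^n}\otimes\mathbb{C}^{d''}$ such that $$\mathbb{E}_{(b,a)\sim\mu_1}\big\|f_X(a)f_Z(b)-V^\dagger\big(X(a)Z(b)\otimes I_{d''}\big)V\big\|_\sigma^2\le C\delta,$$ where $C$ is an absolute constant.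
   Context: For a positive semidefinite $\sigma$, $\|A\|_\sigma^2=\mathrm{Tr}(A^\dagger A\sigma)$. $U(\mathbb{C}^d)$ is the group of $d\times d$ unitaries. For $a\in\{0,1\}^n$, $X(a)=X^{a_1}\otimes\cdots\otimes X^{a_n}$ and $Z(b)=Z^{b_1}\otimes\cdots\otimes Z^{b_n}$ are tensor products of single-qubit Pauli matrices ($X^0=Z^0=I$); $a\cdot b$ is the inner product mod 2 and addition of bit strings is mod 2. *)

theory Defs
  imports
    "HOL-Probability.Probability_Mass_Function"
    "HOL-Library.Z2"
    "Jordan_Normal_Form.Schur_Decomposition"
begin

definition mat_trace :: "'a :: comm_monoid_add mat \<Rightarrow> 'a" where
  "mat_trace A = (\<Sum>i<dim_row A. A $$ (i, i))"

definition psd_mat :: "nat \<Rightarrow> complex mat \<Rightarrow> bool" where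
  "psd_mat d \<sigma> \<longleftrightarrow> \<sigma> \<in> carrier_mat d d \<and> mat_adjoint \<sigma> = \<sigma> \<and>
     (\<forall>v \<in> carrier_vec d. 0 \<le> (\<sigma> *\<^sub>v v) \<bullet>c v)"

definition unitary_mat :: "nat \<Rightarrow> complex mat \<Rightarrow> bool" where
  "unitary_mat d U \<longleftrightarrow> U \<in> carrier_mat d d \<and>
     mat_adjoint U * U = 1\<^sub>m d \<and> U * mat_adjoint U = 1\<^sub>m d"

text \<open>An isometry from complex \<open>d\<close>-space to complex \<open>m\<close>-space, as an \<open>m\<close> by \<open>d\<close> matrix.\<close>

definition isometry_mat :: "nat \<Rightarrow> nat \<Rightarrow> complex mat \<Rightarrow> bool" where
  "isometry_mat d m V \<longleftrightarrow> V \<in> carrier_mat m d \<and> mat_adjoint V * V = 1\<^sub>m d"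

text \<open>For positive semidefinite \<open>\<sigma>\<close> the trace is a nonnegative real number
  (lemma \<open>mat_trace_state_norm_nonneg\<close> below), so taking the real part loses nothing.\<close>

definition state_norm_sq :: "complex mat \<Rightarrow> complex mat \<Rightarrow> real" where
  "state_norm_sq \<sigma> A = Re (mat_trace (mat_adjoint A * A * \<sigma>))"

text \<open>The Kronecker product. The spaces of dimension \<open>m\<close> and \<open>k\<close> tensor to the space of
  dimension \<open>m * k\<close>, with the product of basis vectors \<open>i\<close> and \<open>j\<close> being basis vector
  \<open>i * k + j\<close>.\<close>

definition kron_mat :: "'a :: semiring_0 mat \<Rightarrow> 'a mat \<Rightarrow> 'a mat" (infixr \<open>\<otimes>\<^sub>m\<close> 70) where
  "A \<otimes>\<^sub>m B = mat (dim_row A * dim_row B) (dim_col A * dim_col B)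
     (\<lambda>(i, j). A $$ (i div dim_row B, j div dim_col B) * B $$ (i mod dim_row B, j mod dim_col B))"

definition sigma_X :: "complex mat" where
  "sigma_X = mat_of_rows_list 2 [[0, 1], [1, 0]]"

definition sigma_Z :: "complex mat" where
  "sigma_Z = mat_of_rows_list 2 [[1, 0], [0, -1]]"

text \<open>Bit strings of length \<open>n\<close> are the vectors in \<open>carrier_vec n\<close> over the two-element field
  \<open>bit\<close>, so that vector addition and \<open>scalar_prod\<close> are the operations mod 2. A bit used as an
  exponent is read as the number 0 or 1 through \<open>of_bool\<close>.\<close>

definition pauli_string :: "complex mat \<Rightarrow> bit vec \<Rightarrow> complex mat" where
  "pauli_string P a =
     foldr (\<otimes>\<^sub>m) (map (\<lambda>x. P ^\<^sub>m of_bool (x = 1)) (list_of_vec a)) (1\<^sub>m 1)"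

definition pauli_X :: "bit vec \<Rightarrow> complex mat" where
  "pauli_X = pauli_string sigma_X"

definition pauli_Z :: "bit vec \<Rightarrow> complex mat" where
  "pauli_Z = pauli_string sigma_Z"

definition dot_sign :: "bit vec \<Rightarrow> bit vec \<Rightarrow> complex" where
  "dot_sign a b = (-1) ^ of_bool (scalar_prod a b = 1)"

text \<open>The distribution of \<open>(b + r, a)\<close> for \<open>(b, a)\<close> drawn from \<open>\<mu>\<close> and an independent
  uniform \<open>r\<close>.\<close>

definition randomize_fst :: "nat \<Rightarrow> (bit vec \<times> bit vec) pmf \<Rightarrow> (bit vec \<times> bit vec) pmf" where
  "randomize_fst n \<mu> =
     map_pmf (\<lambda>((b, a), r). (b + r, a)) (pair_pmf \<mu> (pmf_of_set (carrier_vec n)))"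

definition involutive_unitary_rep :: "nat \<Rightarrow> nat \<Rightarrow> (bit vec \<Rightarrow> complex mat) \<Rightarrow> bool" where
  "involutive_unitary_rep n d f \<longleftrightarrow>
     (\<forall>a \<in> carrier_vec n. unitary_mat d (f a) \<and> mat_adjoint (f a) = f a \<and> f a * f a = 1\<^sub>m d) \<and>
     (\<forall>a \<in> carrier_vec n. \<forall>b \<in> carrier_vec n. f a * f b = f (a + b))"


text \<open>The set of bit strings is finite and nonempty, so \<open>pmf_of_set\<close> above is the uniform
  distribution on it.\<close>

lemma card_bitstrings: "card (carrier_vec n :: bit vec set) = 2 ^ n"
  and finite_bitstrings: "finite (carrier_vec n :: bit vec set)"
proof -
  have x: "x = 0 \<or> x = 1" for x :: bit by (rule bit.exhaust[of x]; blast)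
  then have U: "(UNIV :: bit set) = {0, 1}" by blast
  have L: "carrier_vec n = vec_of_list ` {xs :: bit list. set xs \<subseteq> UNIV \<and> length xs = n}"
  proof (intro equalityI subsetI)
    fix v :: "bit vec" assume v: "v \<in> carrier_vec n"
    have "v = vec_of_list (list_of_vec v)" by (simp only: vec_list)
    moreover have "length (list_of_vec v) = n" using v by simp
    ultimately show "v \<in> vec_of_list ` {xs. set xs \<subseteq> UNIV \<and> length xs = n}" by blast
  next
    fix v :: "bit vec" assume "v \<in> vec_of_list ` {xs. set xs \<subseteq> UNIV \<and> length xs = n}"
    then obtain xs where v: "v = vec_of_list xs" and n: "length xs = n" by blast
    show "v \<in> carrier_vec n" unfolding v n[symmetric] by (intro carrier_vecI dim_vec_of_list)
  qed
  have inj: "inj_on (vec_of_list :: bit list \<Rightarrow> bit vec) A" for A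
    by (rule inj_on_inverseI[of _ list_of_vec]) (simp add: list_vec)
  have fU: "finite (UNIV :: bit set)" unfolding U by (rule finite.intros)+
  have cU: "card (UNIV :: bit set) = 2" unfolding U
    by (rule card_2_iff[THEN iffD2]) (use zero_neq_one in blast)
  show "finite (carrier_vec n :: bit vec set)"
    unfolding L by (intro finite_imageI finite_lists_length_eq fU)
  show "card (carrier_vec n :: bit vec set) = 2 ^ n"
    unfolding L card_image[OF inj] card_lists_length_eq[OF fU] cU ..
qed

lemma kron_mat_carrier:
  assumes "A \<in> carrier_mat r c" "B \<in> carrier_mat r' c'"
  shows "A \<otimes>\<^sub>m B \<in> carrier_mat (r * r') (c * c')"
  using assms unfolding kron_mat_def by auto

lemma pauli_string_carrier:
  assumes "P \<in> carrier_mat 2 2"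
  shows "pauli_string P a \<in> carrier_mat (2 ^ dim_vec a) (2 ^ dim_vec a)"
proof -
  have "foldr (\<otimes>\<^sub>m) (map (\<lambda>x. P ^\<^sub>m of_bool (x = 1)) xs) (1\<^sub>m 1)
      \<in> carrier_mat (2 ^ length xs) (2 ^ length xs)" for xs :: "bit list"
  proof (induction xs)
    case (Cons x xs)
    have "P ^\<^sub>m of_bool (x = 1) \<in> carrier_mat 2 2"
      by (rule pow_carrier_mat[OF assms])
    from kron_mat_carrier[OF this Cons.IH] show ?case
      by (simp only: list.map foldr.simps comp_apply list.size power_Suc add_0_right add_Suc_right)
  qed simp
  from this[of "list_of_vec a"] show ?thesis unfolding pauli_string_def by simp
qed

lemma mat_adjoint_index:
  fixes A :: "complex mat"
  assumes "i < dim_col A" "j < dim_row A"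
  shows "mat_adjoint A $$ (i, j) = cnj (A $$ (j, i))"
  using assms unfolding mat_adjoint_def by (auto simp: mat_of_rows_def)

lemma mat_adjoint_dims [simp]:
  fixes A :: "complex mat"
  shows "dim_row (mat_adjoint A) = dim_col A" "dim_col (mat_adjoint A) = dim_row A"
  unfolding mat_adjoint_def by auto

lemma mat_trace_state_norm_nonneg:
  assumes "psd_mat d \<sigma>" and A: "A \<in> carrier_mat m d"
  shows "0 \<le> mat_trace (mat_adjoint A * A * \<sigma>)"
proof -
  have s: "\<sigma> \<in> carrier_mat d d" and pos: "\<And>v. v \<in> carrier_vec d \<Longrightarrow> 0 \<le> (\<sigma> *\<^sub>v v) \<bullet>c v"
    using assms unfolding psd_mat_def by auto
  have "mat_trace (mat_adjoint A * A * \<sigma>) =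
      (\<Sum>i<d. \<Sum>k<d. \<Sum>l<m. cnj (A $$ (l, i)) * A $$ (l, k) * \<sigma> $$ (k, i))"
    using s A by (auto simp: mat_trace_def scalar_prod_def mat_adjoint_index atLeast0LessThan
        sum_distrib_right intro!: sum.cong)
  also have "\<dots> = (\<Sum>i<d. \<Sum>l<m. \<Sum>k<d. cnj (A $$ (l, i)) * A $$ (l, k) * \<sigma> $$ (k, i))"
    by (intro sum.cong refl sum.swap)
  also have "\<dots> = (\<Sum>l<m. \<Sum>i<d. \<Sum>k<d. cnj (A $$ (l, i)) * A $$ (l, k) * \<sigma> $$ (k, i))"
    by (rule sum.swap)
  also have "\<dots> = (\<Sum>l<m. \<Sum>k<d. \<Sum>i<d. cnj (A $$ (l, i)) * A $$ (l, k) * \<sigma> $$ (k, i))"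
    by (intro sum.cong refl sum.swap)
  also have "\<dots> = (\<Sum>l<m. (\<sigma> *\<^sub>v conjugate (row A l)) \<bullet>c conjugate (row A l))"
    using s A by (intro sum.cong refl) (auto simp: scalar_prod_def atLeast0LessThan
        sum_distrib_left sum_distrib_right mult_ac intro!: sum.cong)
  also have "\<dots> \<ge> 0"
    using A by (intro sum_nonneg pos) auto
  finally show ?thesis .
qed

end

theory Submission
  imports Defs
begin

text \<open>
  The witness is the swap isometry \<open>V = \<Sum>x. |x\<rangle> \<otimes> f\<^sub>X(x) R\<^sub>x\<close>, where
  \<open>R\<^sub>x = 2\<^sup>-\<^sup>n \<Sum>b. (-1)\<^bsup>x\<cdot>b\<^esup> f\<^sub>Z(b)\<close> is the joint spectral projection of \<open>f\<^sub>Z\<close>. By orthogonality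
  of characters,
  \<open>V\<^sup>\<dagger> (X(a) Z(b) \<otimes> I) V = \<Sum>y. (-1)\<^bsup>y\<cdot>b\<^esup> R\<^bsub>y+a\<^esub> f\<^sub>X(a) R\<^sub>y = 2\<^sup>-\<^sup>n \<Sum>p. (-1)\<^bsup>a\<cdot>(b+p)\<^esup> f\<^sub>Z(b) f\<^sub>Z(p) f\<^sub>X(a) f\<^sub>Z(p)\<close>.
  Compare both this and \<open>f\<^sub>X(a) f\<^sub>Z(b)\<close> with \<open>(-1)\<^bsup>a\<cdot>b\<^esup> f\<^sub>Z(b) f\<^sub>X(a)\<close>: the second
  difference is the commutation defect at \<open>(b, a)\<close>, and by Jensen's inequality and unitary
  invariance the first is at most the average over uniform \<open>p\<close> of the defect at \<open>(p, a)\<close>.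
  These are controlled by \<open>\<mu>\<^sub>1\<close> and \<open>\<mu>\<^sub>2\<close> respectively, which gives \<open>C = 4\<close>.
\<close>

subsection \<open>Bit strings and signs\<close>

lemma bit_cases: "x = 0 \<or> x = 1" for x :: bit
  by (cases x) auto

lemma bitvec_add_self: "v \<in> carrier_vec n \<Longrightarrow> v + v = 0\<^sub>v n" for v :: "bit vec"
  by (intro eq_vecI) auto

lemma bitvec_add_cancel:
  fixes v w :: "bit vec"
  assumes "v \<in> carrier_vec n" "w \<in> carrier_vec n"
  shows "(v + w) + w = v" "w + (w + v) = v"
proof -
  show "(v + w) + w = v"
    using assms bitvec_add_self[of w n] by (simp add: assoc_add_vec[of v n w w])
  show "w + (w + v) = v"
    using assms bitvec_add_self[of w n] by (simp add: assoc_add_vec[of w n w v, symmetric])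
qed

lemma bij_betw_add_bitvec:
  assumes "w \<in> carrier_vec n"
  shows "bij_betw (\<lambda>v. v + w) (carrier_vec n) (carrier_vec n :: bit vec set)"
  by (rule bij_betw_byWitness[where f' = "\<lambda>v. v + w"])
    (use assms bitvec_add_cancel in auto)

lemma dot_sign_cases: "dot_sign a b = 1 \<or> dot_sign a b = -1"
  unfolding dot_sign_def by (cases "a \<bullet> b = 1") auto

lemma cnj_dot_sign [simp]: "cnj (dot_sign a b) = dot_sign a b"
  using dot_sign_cases[of a b] by auto

lemma dot_sign_add_left:
  assumes "a \<in> carrier_vec n" "b \<in> carrier_vec n" "c \<in> carrier_vec n"
  shows "dot_sign (a + b) c = dot_sign a c * dot_sign b c"
proof -
  have "(a + b) \<bullet> c = a \<bullet> c + b \<bullet> c"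
    using assms by (rule add_scalar_prod_distrib)
  then show ?thesis
    unfolding dot_sign_def using bit_cases[of "a \<bullet> c"] bit_cases[of "b \<bullet> c"] by auto
qed

lemma dot_sign_add_right:
  assumes "a \<in> carrier_vec n" "b \<in> carrier_vec n" "c \<in> carrier_vec n"
  shows "dot_sign a (b + c) = dot_sign a b * dot_sign a c"
proof -
  have "a \<bullet> (b + c) = a \<bullet> b + a \<bullet> c"
    using assms by (rule scalar_prod_add_distrib)
  then show ?thesis
    unfolding dot_sign_def using bit_cases[of "a \<bullet> c"] bit_cases[of "a \<bullet> b"] by auto
qed

lemma dot_sign_zero [simp]: "b \<in> carrier_vec n \<Longrightarrow> dot_sign (0\<^sub>v n) b = 1"
  "b \<in> carrier_vec n \<Longrightarrow> dot_sign b (0\<^sub>v n) = 1"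
  unfolding dot_sign_def by auto

text \<open>If \<open>b\<close> has a nonzero coordinate \<open>i\<close>, translation by the
  \<open>i\<close>-th unit vector permutes the strings and flips every sign, so the sum equals its
  own negative. This is the orthogonality of characters on which the compression formula
  rests.\<close>

lemma sum_dot_sign:
  assumes b: "b \<in> carrier_vec n"
  shows "(\<Sum>x\<in>carrier_vec n. dot_sign x b) = (if b = 0\<^sub>v n then 2 ^ n else 0)"
proof (cases "b = 0\<^sub>v n")
  case True
  then show ?thesis by (simp add: card_bitstrings)
next
  case False
  then obtain i where i: "i < n" "b $ i \<noteq> 0"
    using b by (auto simp: vec_eq_iff)
  let ?e = "unit_vec n i :: bit vec"
  have "?e \<bullet> b = 1"
    using i b bit_cases[of "b $ i"] by (simp add: scalar_prod_left_unit)
  then have flip: "dot_sign (x + ?e) b = - dot_sign x b" if "x \<in> carrier_vec n" for x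
    using that b by (subst dot_sign_add_left[of _ n]) (auto simp: dot_sign_def)
  have "(\<Sum>x\<in>carrier_vec n. dot_sign x b) = (\<Sum>x\<in>carrier_vec n. dot_sign (x + ?e) b)"
    by (rule sum.reindex_bij_betw[OF bij_betw_add_bitvec, symmetric]) simp
  also have "\<dots> = - (\<Sum>x\<in>carrier_vec n. dot_sign x b)"
    by (simp add: flip sum_negf)
  finally show ?thesis using False by simp
qed

text \<open>Most significant bit first, to match the Kronecker convention: the quotient by
  \<open>2 ^ n\<close> indexes the first tensor factor and the remainder indexes the rest.\<close>

fun bits :: "nat \<Rightarrow> nat \<Rightarrow> bit list" where
  "bits 0 i = []"
| "bits (Suc n) i = of_bool (i div 2 ^ n = 1) # bits n (i mod 2 ^ n)"

lemma length_bits [simp]: "length (bits n i) = n"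
  by (induction n arbitrary: i) auto

lemma div_cases: "i < 2 ^ Suc n \<Longrightarrow> i div 2 ^ n = 0 \<or> i div 2 ^ n = 1" for i :: nat
  using less_mult_imp_div_less[of i 2 "2 ^ n"] by auto

lemma bits_inject: "i < 2 ^ n \<Longrightarrow> j < 2 ^ n \<Longrightarrow> bits n i = bits n j \<Longrightarrow> i = j"
proof (induction n arbitrary: i j)
  case (Suc n)
  then have "i mod 2 ^ n = j mod 2 ^ n" by auto
  moreover have "i div 2 ^ n = j div 2 ^ n"
    using Suc.prems div_cases[of i n] div_cases[of j n] by auto
  ultimately show ?case by (metis div_mult_mod_eq)
qed auto

definition bitvec :: "nat \<Rightarrow> nat \<Rightarrow> bit vec" where
  "bitvec n i = vec_of_list (bits n i)"

lemma bitvec_carrier [simp]: "bitvec n i \<in> carrier_vec n"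
  unfolding bitvec_def by (intro carrier_vecI) simp

text \<open>Injectivity comes from rebuilding an index out of quotient and remainder, and
  surjectivity from counting. The bijection turns sums over matrix indices into sums over bit
  strings.\<close>

lemma bij_betw_bitvec: "bij_betw (bitvec n) {..<2 ^ n} (carrier_vec n)"
proof -
  have inj: "inj_on (bitvec n) {..<2 ^ n}"
    by (rule inj_onI) (metis bits_inject bitvec_def lessThan_iff list_vec)
  moreover have "bitvec n ` {..<2 ^ n} = carrier_vec n"
    by (rule card_subset_eq) (auto simp: finite_bitstrings card_bitstrings card_image[OF inj])
  ultimately show ?thesis unfolding bij_betw_def by blast
qed

subsection \<open>Pauli matrices indexed by bit strings\<close>

lemma kron_index:
  "i < dim_row A * dim_row B \<Longrightarrow> j < dim_col A * dim_col B \<Longrightarrow>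
   (A \<otimes>\<^sub>m B) $$ (i, j) = A $$ (i div dim_row B, j div dim_col B) * B $$ (i mod dim_row B, j mod dim_col B)"
  unfolding kron_mat_def by simp

lemma kron_one:
  "1\<^sub>m m \<otimes>\<^sub>m 1\<^sub>m d = (1\<^sub>m (m * d) :: 'a :: semiring_1 mat)"
proof (rule eq_matI)
  fix i j assume ij: "i < dim_row (1\<^sub>m (m * d))" "j < dim_col (1\<^sub>m (m * d))"
  \<comment> \<open>An index below \<open>m * d\<close> can only exist if \<open>d\<close> is
    nonzero, so the divisions by \<open>d\<close> below are genuine.\<close>
  then have d: "d > 0" by (cases d) auto
  have "i div d < m" "j div d < m"
    using ij less_mult_imp_div_less by auto
  moreover have "i = j \<longleftrightarrow> i div d = j div d \<and> i mod d = j mod d"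
    by (metis div_mult_mod_eq)
  ultimately show "(1\<^sub>m m \<otimes>\<^sub>m 1\<^sub>m d) $$ (i, j) = (1\<^sub>m (m * d) :: 'a mat) $$ (i, j)"
    using ij d by (auto simp: kron_index)
qed (auto simp: kron_mat_def)

text \<open>Over lists, an induction can peel off the first tensor factor.\<close>

definition pauli_list :: "complex mat \<Rightarrow> bit list \<Rightarrow> complex mat" where
  "pauli_list P xs = foldr (\<otimes>\<^sub>m) (map (\<lambda>x. P ^\<^sub>m of_bool (x = 1)) xs) (1\<^sub>m 1)"

lemma pauli_string_eq_list: "pauli_string P a = pauli_list P (list_of_vec a)"
  unfolding pauli_string_def pauli_list_def ..

lemma pauli_list_Nil [simp]: "pauli_list P [] = 1\<^sub>m 1"
  unfolding pauli_list_def by simp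

lemma pauli_list_carrier:
  assumes "P \<in> carrier_mat 2 2"
  shows "pauli_list P xs \<in> carrier_mat (2 ^ length xs) (2 ^ length xs)"
  using pauli_string_carrier[OF assms, of "vec_of_list xs"]
  by (simp add: pauli_string_eq_list list_vec)

lemma pauli_list_Cons_index:
  assumes P: "P \<in> carrier_mat 2 2" and ij: "i < 2 ^ Suc (length xs)" "j < 2 ^ Suc (length xs)"
  shows "pauli_list P (x # xs) $$ (i, j) =
    (P ^\<^sub>m of_bool (x = 1)) $$ (i div 2 ^ length xs, j div 2 ^ length xs) *
    pauli_list P xs $$ (i mod 2 ^ length xs, j mod 2 ^ length xs)"
proof -
  have d: "dim_row (P ^\<^sub>m of_bool (x = 1)) = 2" "dim_col (P ^\<^sub>m of_bool (x = 1)) = 2"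
    using pow_carrier_mat[OF P, of "of_bool (x = 1)"] by auto
  have e: "dim_row (pauli_list P xs) = 2 ^ length xs" "dim_col (pauli_list P xs) = 2 ^ length xs"
    using pauli_list_carrier[OF P, of xs] by auto
  have "pauli_list P (x # xs) = P ^\<^sub>m of_bool (x = 1) \<otimes>\<^sub>m pauli_list P xs"
    by (simp add: pauli_list_def)
  then show ?thesis
    using ij by (simp only: kron_index d e power_Suc)
qed

lemma sigma_X_carrier [simp]: "sigma_X \<in> carrier_mat 2 2"
  and sigma_Z_carrier [simp]: "sigma_Z \<in> carrier_mat 2 2"
  unfolding sigma_X_def sigma_Z_def by (auto simp: mat_of_rows_list_def)

lemma pow_of_bool: "P \<in> carrier_mat 2 2 \<Longrightarrow> P ^\<^sub>m of_bool b = (if b then P else 1\<^sub>m 2)"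
  for P :: "complex mat" by auto

text \<open>A single factor has entry 1 exactly when the row bit is the column bit plus
  \<open>x\<close>. The leading bits of the two indices select the entry of the first factor, so the
  condition accumulates bit by bit.\<close>

lemma pauli_list_X_index:
  "i < 2 ^ length xs \<Longrightarrow> j < 2 ^ length xs \<Longrightarrow>
   pauli_list sigma_X xs $$ (i, j) = of_bool (bits (length xs) i = map2 (+) (bits (length xs) j) xs)"
proof (induction xs arbitrary: i j)
  case (Cons x xs)
  let ?m = "2 ^ length xs :: nat"
  have "(sigma_X ^\<^sub>m of_bool (x = 1)) $$ (i div ?m, j div ?m) =
    of_bool (of_bool (i div ?m = 1) = (of_bool (j div ?m = 1) + x :: bit))"
    using div_cases[of i "length xs"] div_cases[of j "length xs"] Cons.prems bit_cases[of x]
    by (auto simp: pow_of_bool sigma_X_def mat_of_rows_list_def)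
  moreover have "pauli_list sigma_X xs $$ (i mod ?m, j mod ?m) =
    of_bool (bits (length xs) (i mod ?m) = map2 (+) (bits (length xs) (j mod ?m)) xs)"
    by (rule Cons.IH) simp_all
  ultimately show ?case
    using Cons.prems by (simp add: pauli_list_Cons_index)
qed auto

lemma pauli_list_Z_index:
  "i < 2 ^ length xs \<Longrightarrow> j < 2 ^ length xs \<Longrightarrow>
   pauli_list sigma_Z xs $$ (i, j) =
     of_bool (i = j) * (-1) ^ of_bool (sum_list (map2 (*) (bits (length xs) j) xs) = 1)"
proof (induction xs arbitrary: i j)
  case (Cons x xs)
  let ?m = "2 ^ length xs :: nat"
  let ?s = "sum_list (map2 (*) (bits (length xs) (j mod ?m)) xs)"
  have "(sigma_Z ^\<^sub>m of_bool (x = 1)) $$ (i div ?m, j div ?m) =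
    of_bool (i div ?m = j div ?m) * (-1) ^ of_bool (of_bool (j div ?m = 1) * x = (1 :: bit))"
    using div_cases[of i "length xs"] div_cases[of j "length xs"] Cons.prems bit_cases[of x]
    by (auto simp: pow_of_bool sigma_Z_def mat_of_rows_list_def)
  moreover have "i = j \<longleftrightarrow> i div ?m = j div ?m \<and> i mod ?m = j mod ?m"
    by (metis div_mult_mod_eq)
  moreover have "pauli_list sigma_Z xs $$ (i mod ?m, j mod ?m) =
    of_bool (i mod ?m = j mod ?m) * (-1) ^ of_bool (?s = 1)"
    by (rule Cons.IH) simp_all
  \<comment> \<open>The sign is multiplicative in the bit sum, so the signs of the diagonal factors
    combine into the sign of the inner product.\<close>
  moreover have "(-1 :: complex) ^ of_bool (y + z = 1) = (-1) ^ of_bool (y = 1) * (-1) ^ of_bool (z = 1)"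
    for y z :: bit
    using bit_cases[of y] bit_cases[of z] by auto
  ultimately show ?case
    using Cons.prems
    by (simp only: pauli_list_Cons_index sigma_Z_carrier list.size bits.simps zip_Cons_Cons
        list.map prod.case sum_list.Cons add_0_right add_Suc_right of_bool_conj mult_ac)
qed auto

text \<open>\<open>pauli_Z b\<close> is diagonal, so the product merely scales each column of the
  permutation matrix \<open>pauli_X a\<close> by a sign.\<close>

lemma pauli_XZ_index:
  assumes a: "a \<in> carrier_vec n" and b: "b \<in> carrier_vec n" and i: "i < 2 ^ n" and j: "j < 2 ^ n"
  shows "(pauli_X a * pauli_Z b) $$ (i, j) =
    of_bool (bitvec n i = bitvec n j + a) * dot_sign (bitvec n j) b"
proof -
  define xs ys where "xs = list_of_vec a" and "ys = list_of_vec b"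
  have l: "length xs = n" "length ys = n" using a b by (auto simp: xs_def ys_def)
  have X: "pauli_X a = pauli_list sigma_X xs" and Z: "pauli_Z b = pauli_list sigma_Z ys"
    by (simp_all only: pauli_X_def pauli_Z_def pauli_string_eq_list xs_def ys_def)
  have Xc: "pauli_X a \<in> carrier_mat (2 ^ n) (2 ^ n)" and Zc: "pauli_Z b \<in> carrier_mat (2 ^ n) (2 ^ n)"
    using pauli_string_carrier[of sigma_X a] pauli_string_carrier[of sigma_Z b] a b
    by (auto simp: pauli_X_def pauli_Z_def)
  have "bitvec n j + a = vec_of_list (map2 (+) (bits n j) xs)"
    using a by (intro eq_vecI) (auto simp: bitvec_def xs_def vec_of_list_index list_of_vec_index)
  then have add: "bitvec n i = bitvec n j + a \<longleftrightarrow> bits n i = map2 (+) (bits n j) xs"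
    unfolding bitvec_def by (metis list_vec)
  have dot: "bitvec n j \<bullet> b = sum_list (map2 (*) (bits n j) ys)"
    using b by (simp add: bitvec_def ys_def scalar_prod_def vec_of_list_index list_of_vec_index sum_list_sum_nth)
  have Z_index: "pauli_Z b $$ (k, j) = (if k = j then dot_sign (bitvec n j) b else 0)" if "k < 2 ^ n" for k
    using pauli_list_Z_index[of k ys j] that j l by (simp only: Z dot_sign_def dot) auto
  have "(pauli_X a * pauli_Z b) $$ (i, j) = (\<Sum>k<2 ^ n. pauli_X a $$ (i, k) * pauli_Z b $$ (k, j))"
    using Xc Zc i j by (auto simp: scalar_prod_def atLeast0LessThan)
  also have "\<dots> = (\<Sum>k<2 ^ n. if k = j then pauli_X a $$ (i, j) * dot_sign (bitvec n j) b else 0)"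
    by (intro sum.cong refl) (auto simp: Z_index)
  also have "\<dots> = pauli_X a $$ (i, j) * dot_sign (bitvec n j) b"
    using j by simp
  finally show ?thesis
    using pauli_list_X_index[of i xs j] i j l by (simp only: X add)
qed

subsection \<open>Finite sums of matrices\<close>

text \<open>The dimensions are explicit because matrices of different sizes share one type, and an
  empty sum must still be a zero matrix of a definite size.\<close>

definition mat_sum :: "nat \<Rightarrow> nat \<Rightarrow> ('b \<Rightarrow> 'a :: comm_monoid_add mat) \<Rightarrow> 'b set \<Rightarrow> 'a mat" where
  "mat_sum r c g S = mat r c (\<lambda>ij. \<Sum>x\<in>S. g x $$ ij)"

lemma mat_sum_dims [simp]: "dim_row (mat_sum r c g S) = r" "dim_col (mat_sum r c g S) = c"
  unfolding mat_sum_def by auto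

lemma mat_sum_carrier [simp]: "mat_sum r c g S \<in> carrier_mat r c"
  unfolding mat_sum_def by auto

lemma mat_sum_index [simp]:
  "i < r \<Longrightarrow> j < c \<Longrightarrow> mat_sum r c g S $$ (i, j) = (\<Sum>x\<in>S. g x $$ (i, j))"
  unfolding mat_sum_def by auto

lemma mat_sum_cong:
  "(\<And>x. x \<in> S \<Longrightarrow> g x = h x) \<Longrightarrow> mat_sum r c g S = mat_sum r c h S"
  unfolding mat_sum_def by (auto intro!: sum.cong)

lemma mat_sum_reindex_bij_betw:
  "bij_betw p S T \<Longrightarrow> mat_sum r c (\<lambda>x. g (p x)) S = mat_sum r c g T"
  unfolding mat_sum_def using sum.reindex_bij_betw[of p S T] by (intro eq_matI) auto

lemma mult_mat_sum:
  fixes A :: "'a :: comm_semiring_0 mat"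
  assumes A: "A \<in> carrier_mat m r" and g: "\<And>x. x \<in> S \<Longrightarrow> g x \<in> carrier_mat r c"
  shows "A * mat_sum r c g S = mat_sum m c (\<lambda>x. A * g x) S"
proof (rule eq_matI)
  fix i j assume ij: "i < dim_row (mat_sum m c (\<lambda>x. A * g x) S)" "j < dim_col (mat_sum m c (\<lambda>x. A * g x) S)"
  have "(A * mat_sum r c g S) $$ (i, j) = (\<Sum>k<r. \<Sum>x\<in>S. A $$ (i, k) * g x $$ (k, j))"
    using A ij by (auto simp: scalar_prod_def atLeast0LessThan sum_distrib_left intro!: sum.cong)
  also have "\<dots> = (\<Sum>x\<in>S. \<Sum>k<r. A $$ (i, k) * g x $$ (k, j))"
    by (rule sum.swap)
  also have "\<dots> = mat_sum m c (\<lambda>x. A * g x) S $$ (i, j)"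
    using A ij g[THEN carrier_matD(1)] g[THEN carrier_matD(2)] by (auto simp: scalar_prod_def atLeast0LessThan intro!: sum.cong)
  finally show "(A * mat_sum r c g S) $$ (i, j) = mat_sum m c (\<lambda>x. A * g x) S $$ (i, j)" .
qed (use A in auto)

lemma mat_sum_mult:
  fixes A :: "'a :: comm_semiring_0 mat"
  assumes A: "A \<in> carrier_mat c m" and g: "\<And>x. x \<in> S \<Longrightarrow> g x \<in> carrier_mat r c"
  shows "mat_sum r c g S * A = mat_sum r m (\<lambda>x. g x * A) S"
proof (rule eq_matI)
  fix i j assume ij: "i < dim_row (mat_sum r m (\<lambda>x. g x * A) S)" "j < dim_col (mat_sum r m (\<lambda>x. g x * A) S)"
  have "(mat_sum r c g S * A) $$ (i, j) = (\<Sum>k<c. \<Sum>x\<in>S. g x $$ (i, k) * A $$ (k, j))"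
    using A ij by (auto simp: scalar_prod_def atLeast0LessThan sum_distrib_right intro!: sum.cong)
  also have "\<dots> = (\<Sum>x\<in>S. \<Sum>k<c. g x $$ (i, k) * A $$ (k, j))"
    by (rule sum.swap)
  also have "\<dots> = mat_sum r m (\<lambda>x. g x * A) S $$ (i, j)"
    using A ij g[THEN carrier_matD(1)] g[THEN carrier_matD(2)] by (auto simp: scalar_prod_def atLeast0LessThan intro!: sum.cong)
  finally show "(mat_sum r c g S * A) $$ (i, j) = mat_sum r m (\<lambda>x. g x * A) S $$ (i, j)" .
qed (use A in auto)

lemma mat_sum_smult_const:
  fixes A :: "'a :: comm_semiring_0 mat"
  assumes "A \<in> carrier_mat r c"
  shows "mat_sum r c (\<lambda>x. f x \<cdot>\<^sub>m A) S = (\<Sum>x\<in>S. f x) \<cdot>\<^sub>m A"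
  using assms by (intro eq_matI) (auto simp: sum_distrib_right)

lemma mat_sum_minus:
  fixes g h :: "'b \<Rightarrow> 'a :: ab_group_add mat"
  assumes "\<And>x. x \<in> S \<Longrightarrow> g x \<in> carrier_mat r c" "\<And>x. x \<in> S \<Longrightarrow> h x \<in> carrier_mat r c"
  shows "mat_sum r c (\<lambda>x. g x - h x) S = mat_sum r c g S - mat_sum r c h S"
  using assms(2)[THEN carrier_matD(1)] assms(2)[THEN carrier_matD(2)]
  by (intro eq_matI) (auto simp: sum_subtractf[symmetric] intro!: sum.cong)

lemma mat_sum_delta:
  assumes "finite S" "y \<in> S" "g y \<in> carrier_mat r c" "\<And>x. x \<in> S \<Longrightarrow> x \<noteq> y \<Longrightarrow> g x = 0\<^sub>m r c"
  shows "mat_sum r c g S = g y"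
proof (rule eq_matI)
  fix i j assume ij: "i < dim_row (g y)" "j < dim_col (g y)"
  have "(\<Sum>x\<in>S. g x $$ (i, j)) = (\<Sum>x\<in>S. if x = y then g y $$ (i, j) else 0)"
    using assms ij by (intro sum.cong) auto
  then show "mat_sum r c g S $$ (i, j) = g y $$ (i, j)"
    using assms ij by auto
qed (use assms in auto)

lemma smult_smult_mat: "a \<cdot>\<^sub>m (b \<cdot>\<^sub>m A) = (a * b) \<cdot>\<^sub>m A" for a b :: "'a :: semigroup_mult"
  by (intro eq_matI) (auto simp: mult.assoc)

subsection \<open>The adjoint and the state-dependent seminorm\<close>

lemma adjoint_carrier [simp]: "A \<in> carrier_mat r c \<Longrightarrow> mat_adjoint A \<in> carrier_mat c r"
  for A :: "complex mat"
  by (intro carrier_matI) auto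

lemma adjoint_mat_sum:
  fixes g :: "'b \<Rightarrow> complex mat"
  assumes "\<And>x. x \<in> S \<Longrightarrow> g x \<in> carrier_mat r c"
  shows "mat_adjoint (mat_sum r c g S) = mat_sum c r (\<lambda>x. mat_adjoint (g x)) S"
  using assms[THEN carrier_matD(1)] assms[THEN carrier_matD(2)]
  by (intro eq_matI) (auto simp: mat_adjoint_index intro!: sum.cong)

lemma adjoint_smult: "mat_adjoint (a \<cdot>\<^sub>m A) = cnj a \<cdot>\<^sub>m mat_adjoint A" for A :: "complex mat"
  by (intro eq_matI) (auto simp: mat_adjoint_index)

lemma adjoint_mult:
  fixes A B :: "complex mat"
  assumes "A \<in> carrier_mat r m" "B \<in> carrier_mat m c"
  shows "mat_adjoint (A * B) = mat_adjoint B * mat_adjoint A"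
  using assms by (intro eq_matI) (auto simp: mat_adjoint_index scalar_prod_def mult.commute intro!: sum.cong)

lemma state_norm_sq_nonneg:
  "psd_mat d \<sigma> \<Longrightarrow> A \<in> carrier_mat m d \<Longrightarrow> 0 \<le> state_norm_sq \<sigma> A"
  using mat_trace_state_norm_nonneg[of d \<sigma> A m] by (simp add: state_norm_sq_def less_eq_complex_def)

text \<open>The seminorm sees \<open>A\<close> only through the product of its adjoint with
  \<open>A\<close>, where the left factor cancels. Right factors do not cancel in general, so the
  error estimate keeps its extra unitaries on the left.\<close>

lemma state_norm_sq_isometry_mult:
  assumes "U \<in> carrier_mat k m" "mat_adjoint U * U = 1\<^sub>m m" "A \<in> carrier_mat m d"
  shows "state_norm_sq \<sigma> (U * A) = state_norm_sq \<sigma> A"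
proof -
  have "mat_adjoint (U * A) * (U * A) = mat_adjoint A * (mat_adjoint U * (U * A))"
    using assms by (simp add: adjoint_mult[of U k m A d] assoc_mult_mat[of _ d m _ k _ d])
  also have "mat_adjoint U * (U * A) = A"
    using assms by (simp add: assoc_mult_mat[of _ m k U m A d, symmetric])
  finally show ?thesis by (simp add: state_norm_sq_def)
qed

lemma state_norm_sq_smult:
  assumes "\<sigma> \<in> carrier_mat d d" "A \<in> carrier_mat m d"
  shows "state_norm_sq \<sigma> (a \<cdot>\<^sub>m A) = (cmod a)\<^sup>2 * state_norm_sq \<sigma> A"
proof -
  have AA: "mat_adjoint A * A \<in> carrier_mat d d"
    using assms by (intro mult_carrier_mat) auto
  have "mat_adjoint (a \<cdot>\<^sub>m A) * (a \<cdot>\<^sub>m A) * \<sigma> = (cnj a * a) \<cdot>\<^sub>m (mat_adjoint A * A * \<sigma>)"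
    using assms AA by (simp add: adjoint_smult mult_smult_assoc_mat[of _ d m _ d]
        mult_smult_distrib[of _ d m _ d] mult_smult_assoc_mat[of "mat_adjoint A * A" d d \<sigma> d] smult_smult_mat mult.commute)
  moreover have "mat_trace (b \<cdot>\<^sub>m B) = b * mat_trace B" if "B \<in> carrier_mat d d" for b and B :: "complex mat"
    using that by (auto simp: mat_trace_def sum_distrib_left intro!: sum.cong)
  moreover have "cnj a * a = complex_of_real ((cmod a)\<^sup>2)"
    using complex_norm_square[of a] by (simp add: mult.commute)
  moreover have "mat_adjoint A * A * \<sigma> \<in> carrier_mat d d"
    using AA assms(1) by (rule mult_carrier_mat)
  ultimately have "mat_trace (mat_adjoint (a \<cdot>\<^sub>m A) * (a \<cdot>\<^sub>m A) * \<sigma>) =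
      complex_of_real ((cmod a)\<^sup>2) * mat_trace (mat_adjoint A * A * \<sigma>)"
    by (simp only:)
  then show ?thesis
    unfolding state_norm_sq_def by (simp only: Re_complex_of_real Im_complex_of_real times_complex.sel)
qed

text \<open>Jensen's inequality without a square root of \<open>\<sigma>\<close>: expand
  \<open>0 \<le> \<Sum>x y. \<parallel>g x - g y\<parallel>\<^sup>2\<close>.\<close>

lemma state_norm_sq_mat_sum_le:
  fixes g :: "'b \<Rightarrow> complex mat"
  assumes \<sigma>: "psd_mat d \<sigma>" and fin: "finite S" and g: "\<And>x. x \<in> S \<Longrightarrow> g x \<in> carrier_mat m d"
  shows "state_norm_sq \<sigma> (mat_sum m d g S) \<le> card S * (\<Sum>x\<in>S. state_norm_sq \<sigma> (g x))"
proof -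
  have sc: "\<sigma> \<in> carrier_mat d d" using \<sigma> by (simp add: psd_mat_def)
  \<comment> \<open>The real part of the sesquilinear form belonging to the seminorm, written in
    coordinates so that additivity in each argument is a rearrangement of finite sums.\<close>
  define ip where "ip A B = Re (\<Sum>i<d. \<Sum>k<d. \<Sum>l<m. cnj (A $$ (l, i)) * B $$ (l, k) * \<sigma> $$ (k, i))"
    for A B :: "complex mat"
  have norm_ip: "state_norm_sq \<sigma> A = ip A A" if "A \<in> carrier_mat m d" for A
  proof -
    have "mat_trace (mat_adjoint A * A * \<sigma>) =
      (\<Sum>i<d. \<Sum>k<d. \<Sum>l<m. cnj (A $$ (l, i)) * A $$ (l, k) * \<sigma> $$ (k, i))"
      using sc that by (auto simp: mat_trace_def scalar_prod_def mat_adjoint_index atLeast0LessThan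
          sum_distrib_right intro!: sum.cong)
    then show ?thesis by (simp add: state_norm_sq_def ip_def)
  qed
  have diff: "ip (A - B) (A - B) = ip A A + ip B B - ip A B - ip B A"
    if "A \<in> carrier_mat m d" "B \<in> carrier_mat m d" for A B
  proof -
    have "ip (A - B) (A - B) = Re (\<Sum>i<d. \<Sum>k<d. \<Sum>l<m.
        cnj (A $$ (l, i)) * A $$ (l, k) * \<sigma> $$ (k, i) + cnj (B $$ (l, i)) * B $$ (l, k) * \<sigma> $$ (k, i)
        - cnj (A $$ (l, i)) * B $$ (l, k) * \<sigma> $$ (k, i) - cnj (B $$ (l, i)) * A $$ (l, k) * \<sigma> $$ (k, i))"
      unfolding ip_def using that
      by (intro arg_cong[where f = Re] sum.cong refl) (simp add: algebra_simps)
    then show ?thesis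
      by (simp add: ip_def sum.distrib sum_subtractf)
  qed
  have sum_ip: "ip (mat_sum m d g S) (mat_sum m d g S) = (\<Sum>x\<in>S. \<Sum>y\<in>S. ip (g x) (g y))"
  proof -
    have "(\<Sum>x\<in>S. \<Sum>y\<in>S. ip (g x) (g y)) = Re (\<Sum>x\<in>S. \<Sum>y\<in>S. \<Sum>i<d. \<Sum>k<d. \<Sum>l<m.
        cnj (g x $$ (l, i)) * g y $$ (l, k) * \<sigma> $$ (k, i))"
      by (simp add: ip_def)
    also have "(\<Sum>x\<in>S. \<Sum>y\<in>S. \<Sum>i<d. \<Sum>k<d. \<Sum>l<m.
        cnj (g x $$ (l, i)) * g y $$ (l, k) * \<sigma> $$ (k, i)) =
      (\<Sum>i<d. \<Sum>k<d. \<Sum>l<m. \<Sum>(x, y)\<in>S \<times> S. cnj (g x $$ (l, i)) * g y $$ (l, k) * \<sigma> $$ (k, i))"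
      \<comment> \<open>The two sums over \<open>S\<close> are merged into one over pairs, which
        then moves inward past the three coordinate sums.\<close>
      by (simp only: sum.cartesian_product[of _ S S] split_def sum.swap[where A = "S \<times> S"])
    also have "Re \<dots> = ip (mat_sum m d g S) (mat_sum m d g S)"
      unfolding ip_def
      by (intro arg_cong[where f = Re] sum.cong refl)
        (simp only: lessThan_iff mat_sum_index cnj_sum sum_product,
          simp only: sum_distrib_right sum.cartesian_product split_def)
    finally show ?thesis by simp
  qed
  have "0 \<le> (\<Sum>x\<in>S. \<Sum>y\<in>S. state_norm_sq \<sigma> (g x - g y))"
    by (intro sum_nonneg state_norm_sq_nonneg[OF \<sigma> minus_carrier_mat[OF g]])
  also have "\<dots> = (\<Sum>x\<in>S. \<Sum>y\<in>S. ip (g x) (g x) + ip (g y) (g y) - ip (g x) (g y) - ip (g y) (g x))"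
    using g by (intro sum.cong refl, subst norm_ip) (auto intro!: diff minus_carrier_mat)
  \<comment> \<open>Each diagonal term occurs once for every choice of the other index, and
    exchanging \<open>x\<close> and \<open>y\<close> identifies the two cross sums.\<close>
  also have "\<dots> = 2 * (card S * (\<Sum>x\<in>S. ip (g x) (g x))) - 2 * (\<Sum>x\<in>S. \<Sum>y\<in>S. ip (g x) (g y))"
    using sum.swap[of "\<lambda>x y. ip (g y) (g x)" S S]
    by (simp add: sum.distrib sum_subtractf sum_distrib_left[symmetric])
  finally have "(\<Sum>x\<in>S. \<Sum>y\<in>S. ip (g x) (g y)) \<le> card S * (\<Sum>x\<in>S. ip (g x) (g x))"
    by simp
  then show ?thesis
    using g by (simp add: norm_ip sum_ip)
qed

text \<open>The preceding inequality for a two-element index set: \<open>A - C\<close> is the sum of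
  \<open>A - B\<close> and \<open>B - C\<close>, and the cardinality supplies the factor 2.\<close>

lemma state_norm_sq_diff_triangle:
  assumes \<sigma>: "psd_mat d \<sigma>" and c: "A \<in> carrier_mat m d" "B \<in> carrier_mat m d" "C \<in> carrier_mat m d"
  shows "state_norm_sq \<sigma> (A - C) \<le> 2 * state_norm_sq \<sigma> (A - B) + 2 * state_norm_sq \<sigma> (B - C)"
proof -
  define g where "g b = (if b then A - B else B - C)" for b
  have "mat_sum m d g UNIV = A - C"
    using c by (intro eq_matI) (auto simp: UNIV_bool g_def)
  moreover have "g b \<in> carrier_mat m d" for b
    using c by (auto simp: g_def intro!: minus_carrier_mat)
  ultimately show ?thesis
    using state_norm_sq_mat_sum_le[OF \<sigma>, of UNIV g m] by (simp add: UNIV_bool g_def)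
qed


subsection \<open>The swap isometry\<close>

text \<open>The block column with blocks \<open>B 0\<close>, ..., \<open>B (m - 1)\<close>. Under
  the Kronecker convention, this is the sum over \<open>x\<close> of the \<open>x\<close>-th basis
  vector tensored with \<open>B x\<close>.\<close>

definition stack :: "nat \<Rightarrow> nat \<Rightarrow> (nat \<Rightarrow> 'a mat) \<Rightarrow> 'a mat" where
  "stack m d B = mat (m * d) d (\<lambda>(i, j). B (i div d) $$ (i mod d, j))"

lemma sum_lessThan_mult:
  fixes f :: "nat \<Rightarrow> 'a :: comm_monoid_add"
  shows "(\<Sum>k<m * d. f k) = (\<Sum>x<m. \<Sum>u<d. f (x * d + u))"
proof -
  have "(\<Sum>k<m * d. f k) = (\<Sum>x<m. sum f {x * d..<x * d + d})"
    by (rule sum.nat_group[symmetric])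
  also have "\<dots> = (\<Sum>x<m. \<Sum>u<d. f (x * d + u))"
    by (subst sum.atLeastLessThan_shift_0) (simp add: atLeast0LessThan)
  finally show ?thesis .
qed

lemma mult_add_less: "x < m \<Longrightarrow> u < d \<Longrightarrow> x * d + u < m * d" for x u :: nat
  using mult_le_mono1[of "Suc x" m d] by simp

text \<open>The identity factor forces equal positions inside the two blocks that meet, and summing
  over this common position yields the product of the adjoint of \<open>B x\<close> with
  \<open>B y\<close>.\<close>

lemma stack_sandwich:
  fixes P :: "complex mat"
  assumes P: "P \<in> carrier_mat m m" and B: "\<And>x. x < m \<Longrightarrow> B x \<in> carrier_mat d d"
  shows "mat_adjoint (stack m d B) * (P \<otimes>\<^sub>m 1\<^sub>m d) * stack m d B =
    mat_sum d d (\<lambda>y. mat_sum d d (\<lambda>x. P $$ (x, y) \<cdot>\<^sub>m (mat_adjoint (B x) * B y)) {..<m}) {..<m}"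
    (is "?L = ?R")
proof (rule eq_matI)
  fix i j assume "i < dim_row ?R" "j < dim_col ?R"
  then have i: "i < d" and j: "j < d" by auto
  let ?V = "stack m d B" and ?K = "P \<otimes>\<^sub>m 1\<^sub>m d"
  have V: "?V \<in> carrier_mat (m * d) d" by (simp add: stack_def)
  have K: "?K \<in> carrier_mat (m * d) (m * d)"
    using kron_mat_carrier[OF P one_carrier_mat] .
  have V_index: "?V $$ (x * d + u, k) = B x $$ (u, k)" if "x < m" "u < d" "k < d" for x u k
    using that mult_add_less[of x m u d] by (simp add: stack_def)
  have K_index: "?K $$ (x * d + u, y * d + v) = (if u = v then P $$ (x, y) else 0)"
    if "x < m" "u < d" "y < m" "v < d" for x u y v
    using that P mult_add_less[of x m u d] mult_add_less[of y m v d] by (simp add: kron_index)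
  have "?L $$ (i, j) = (\<Sum>l<m * d. (\<Sum>k<m * d. cnj (?V $$ (k, i)) * ?K $$ (k, l)) * ?V $$ (l, j))"
    using V K i j by (auto simp: scalar_prod_def atLeast0LessThan mat_adjoint_index intro!: sum.cong)
  also have "\<dots> = (\<Sum>y<m. \<Sum>v<d. (\<Sum>x<m. \<Sum>u<d.
      cnj (B x $$ (u, i)) * (if u = v then P $$ (x, y) else 0)) * B y $$ (v, j))"
    unfolding sum_lessThan_mult using i j by (intro sum.cong arg_cong2[where f = "(*)"] refl)
      (auto simp: V_index K_index)
  \<comment> \<open>The Kronecker delta of the identity factor removes the sum over
    \<open>u\<close>.\<close>
  also have "\<dots> = (\<Sum>y<m. \<Sum>v<d. \<Sum>x<m. P $$ (x, y) * (cnj (B x $$ (v, i)) * B y $$ (v, j)))"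
    by (intro sum.cong refl)
      (simp add: if_distrib[of "(*) _"] sum_distrib_left sum_distrib_right mult.commute mult.left_commute cong: if_cong)
  also have "\<dots> = (\<Sum>y<m. \<Sum>x<m. \<Sum>v<d. P $$ (x, y) * (cnj (B x $$ (v, i)) * B y $$ (v, j)))"
    by (intro sum.cong refl sum.swap)
  also have "\<dots> = ?R $$ (i, j)"
    using i j B[THEN carrier_matD(1)] B[THEN carrier_matD(2)]
    by (auto simp: scalar_prod_def atLeast0LessThan mat_adjoint_index sum_distrib_left intro!: sum.cong)
  finally show "?L $$ (i, j) = ?R $$ (i, j)" .
qed (auto simp: stack_def)

section \<open>Joint spectral projections of an involutive representation\<close>

lemma involutive_unitary_repD:
  assumes "involutive_unitary_rep n d f" "a \<in> carrier_vec n"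
  shows "f a \<in> carrier_mat d d" "mat_adjoint (f a) = f a" "f a * f a = 1\<^sub>m d"
    "b \<in> carrier_vec n \<Longrightarrow> f a * f b = f (a + b)"
  using assms by (auto simp: involutive_unitary_rep_def unitary_mat_def)

text \<open>The square of the value at zero is that value itself by the group law, and the identity
  by involutivity.\<close>

lemma involutive_unitary_rep_zero:
  assumes "involutive_unitary_rep n d f"
  shows "f (0\<^sub>v n) = 1\<^sub>m d"
  using involutive_unitary_repD(3)[OF assms zero_carrier_vec]
    involutive_unitary_repD(4)[OF assms zero_carrier_vec zero_carrier_vec] by simp

text \<open>For an involutive representation \<open>f\<close>, this projects onto the joint
  eigenspace where every \<open>f b\<close> acts as the scalar \<open>dot_sign x b\<close>.\<close>

definition spectral_proj :: "nat \<Rightarrow> nat \<Rightarrow> (bit vec \<Rightarrow> complex mat) \<Rightarrow> bit vec \<Rightarrow> complex mat" where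
  "spectral_proj n d f x = mat_sum d d (\<lambda>b. (dot_sign x b / 2 ^ n) \<cdot>\<^sub>m f b) (carrier_vec n)"

lemma spectral_proj_carrier [simp]: "spectral_proj n d f x \<in> carrier_mat d d"
  by (simp add: spectral_proj_def)

lemma adjoint_spectral_proj:
  assumes "involutive_unitary_rep n d f"
  shows "mat_adjoint (spectral_proj n d f x) = spectral_proj n d f x"
  unfolding spectral_proj_def using assms
  by (subst adjoint_mat_sum) (auto simp: adjoint_smult involutive_unitary_repD intro!: mat_sum_cong)

text \<open>Bilinear expansion; the two normalizations multiply to \<open>4 ^ n\<close>. In this
  form, the signs can be summed over the labels of the projections.\<close>

lemma spectral_proj_sandwich:
  assumes f: "involutive_unitary_rep n d f" and F: "F \<in> carrier_mat d d"
  shows "spectral_proj n d f x * F * spectral_proj n d f y =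
    mat_sum d d (\<lambda>p. mat_sum d d (\<lambda>q.
      (dot_sign x p * dot_sign y q / 4 ^ n) \<cdot>\<^sub>m (f p * F * f q)) (carrier_vec n)) (carrier_vec n)"
proof -
  note fc = involutive_unitary_repD(1)[OF f]
  have 4: "(4 :: complex) ^ n = 2 ^ n * 2 ^ n" by (simp flip: power_mult_distrib)
  have pF: "f p * F \<in> carrier_mat d d" if "p \<in> carrier_vec n" for p
    using fc[OF that] F by auto
  have "spectral_proj n d f x * F =
      mat_sum d d (\<lambda>p. (dot_sign x p / 2 ^ n) \<cdot>\<^sub>m (f p * F)) (carrier_vec n)"
    unfolding spectral_proj_def using F fc
    by (subst mat_sum_mult[of F d d]) (auto intro!: mat_sum_cong simp: mult_smult_assoc_mat[of _ d d F d])
  also have "\<dots> * spectral_proj n d f y =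
      mat_sum d d (\<lambda>p. ((dot_sign x p / 2 ^ n) \<cdot>\<^sub>m (f p * F)) * spectral_proj n d f y) (carrier_vec n)"
    by (intro mat_sum_mult) (auto simp: pF)
  also have "\<dots> = mat_sum d d (\<lambda>p. mat_sum d d (\<lambda>q.
      (dot_sign x p * dot_sign y q / 4 ^ n) \<cdot>\<^sub>m (f p * F * f q)) (carrier_vec n)) (carrier_vec n)"
  proof (rule mat_sum_cong)
    fix p :: "bit vec" assume p: "p \<in> carrier_vec n"
    have "((dot_sign x p / 2 ^ n) \<cdot>\<^sub>m (f p * F)) * spectral_proj n d f y =
       mat_sum d d (\<lambda>q. ((dot_sign x p / 2 ^ n) \<cdot>\<^sub>m (f p * F)) * ((dot_sign y q / 2 ^ n) \<cdot>\<^sub>m f q)) (carrier_vec n)"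
      unfolding spectral_proj_def using pF[OF p] fc by (intro mult_mat_sum) auto
    also have "\<dots> = mat_sum d d (\<lambda>q.
      (dot_sign x p * dot_sign y q / 4 ^ n) \<cdot>\<^sub>m (f p * F * f q)) (carrier_vec n)"
    proof (rule mat_sum_cong)
      fix q :: "bit vec" assume q: "q \<in> carrier_vec n"
      show "((dot_sign x p / 2 ^ n) \<cdot>\<^sub>m (f p * F)) * ((dot_sign y q / 2 ^ n) \<cdot>\<^sub>m f q) =
        (dot_sign x p * dot_sign y q / 4 ^ n) \<cdot>\<^sub>m (f p * F * f q)"
        using pF[OF p] fc[OF q]
        by (simp add: mult_smult_assoc_mat[of _ d d _ d] mult_smult_distrib[of _ d d _ d]
            smult_smult_mat 4 mult.commute)
    qed
    finally show "((dot_sign x p / 2 ^ n) \<cdot>\<^sub>m (f p * F)) * spectral_proj n d f y =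
      mat_sum d d (\<lambda>q. (dot_sign x p * dot_sign y q / 4 ^ n) \<cdot>\<^sub>m (f p * F * f q)) (carrier_vec n)" .
  qed
  finally show ?thesis .
qed


lemma carrier_mat_mult3:
  "A \<in> carrier_mat d d \<Longrightarrow> B \<in> carrier_mat d d \<Longrightarrow> C \<in> carrier_mat d d \<Longrightarrow> A * B * C \<in> carrier_mat d d"
  by (intro mult_carrier_mat)

text \<open>Expanding both projections and summing over \<open>y\<close> first lets orthogonality
  tie \<open>q\<close> to \<open>p\<close>, so that a double average becomes a single one.\<close>

lemma sum_sign_spectral_proj_sandwich:
  assumes f: "involutive_unitary_rep n d f" and F: "F \<in> carrier_mat d d"
    and a: "a \<in> carrier_vec n" and b: "b \<in> carrier_vec n"
  shows "mat_sum d d (\<lambda>y. dot_sign y b \<cdot>\<^sub>m (spectral_proj n d f (y + a) * F * spectral_proj n d f y)) (carrier_vec n) =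
    mat_sum d d (\<lambda>p. (dot_sign a (b + p) / 2 ^ n) \<cdot>\<^sub>m (f b * f p * F * f p)) (carrier_vec n)"
    (is "?L = ?R")
proof (rule eq_matI)
  fix i j assume "i < dim_row ?R" "j < dim_col ?R"
  then have i: "i < d" and j: "j < d" by auto
  let ?C = "carrier_vec n :: bit vec set"
  define G where "G p q = (f p * F * f q) $$ (i, j)" for p q
  note fc = involutive_unitary_repD(1)[OF f]
  have Gc: "f p * F * f q \<in> carrier_mat d d" if "p \<in> ?C" "q \<in> ?C" for p q
    using fc[OF that(1)] F fc[OF that(2)] by (rule carrier_mat_mult3)
  have G_index: "(c \<cdot>\<^sub>m (f p * F * f q)) $$ (i, j) = c * G p q" if "p \<in> ?C" "q \<in> ?C" for c p q
    using Gc[OF that, THEN carrier_matD(1)] Gc[OF that, THEN carrier_matD(2)] i j by (simp add: G_def)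
  have "?L $$ (i, j) = (\<Sum>y\<in>?C. dot_sign y b * (\<Sum>p\<in>?C. \<Sum>q\<in>?C. dot_sign (y + a) p * dot_sign y q / 4 ^ n * G p q))"
    using i j by (simp add: spectral_proj_sandwich[OF f F] G_index)
  \<comment> \<open>The signs depending on \<open>y\<close> combine into one character at
    \<open>b + p + q\<close>; the shift by \<open>a\<close> leaves the factor
    \<open>dot_sign a p\<close>.\<close>
  also have "\<dots> = (\<Sum>y\<in>?C. \<Sum>p\<in>?C. \<Sum>q\<in>?C. dot_sign a p / 4 ^ n * G p q * dot_sign y (b + p + q))"
    unfolding sum_distrib_left using a b
    by (intro sum.cong refl) (simp add: dot_sign_add_left[of _ n] dot_sign_add_right[of _ n])
  also have "\<dots> = (\<Sum>p\<in>?C. \<Sum>y\<in>?C. \<Sum>q\<in>?C. dot_sign a p / 4 ^ n * G p q * dot_sign y (b + p + q))"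
    by (rule sum.swap)
  also have "\<dots> = (\<Sum>p\<in>?C. \<Sum>q\<in>?C. \<Sum>y\<in>?C. dot_sign a p / 4 ^ n * G p q * dot_sign y (b + p + q))"
    by (intro sum.cong refl sum.swap)
  \<comment> \<open>The character sum is \<open>2 ^ n\<close> when \<open>q = b + p\<close> and zero
    otherwise, which cancels one of the two normalizations in \<open>4 ^ n\<close>.\<close>
  also have "\<dots> = (\<Sum>p\<in>?C. \<Sum>q\<in>?C. if q = b + p then dot_sign a p / 2 ^ n * G p q else 0)"
  proof (intro sum.cong refl)
    fix p q assume pq: "p \<in> ?C" "q \<in> ?C"
    have "b + p + q = 0\<^sub>v n \<longleftrightarrow> q = b + p"
      using bitvec_add_cancel(2)[of q n "b + p"] bitvec_add_self[of "b + p" n] b pq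
      by (metis add_carrier_vec comm_add_vec left_zero_vec right_zero_vec)
    moreover have "(4 :: complex) ^ n = 2 ^ n * 2 ^ n" by (simp flip: power_mult_distrib)
    moreover have "b + p + q \<in> ?C" using b pq by simp
    ultimately show "(\<Sum>y\<in>?C. dot_sign a p / 4 ^ n * G p q * dot_sign y (b + p + q)) =
      (if q = b + p then dot_sign a p / 2 ^ n * G p q else 0)"
      by (simp only: sum_distrib_left[symmetric] sum_dot_sign) simp
  qed
  also have "\<dots> = (\<Sum>p\<in>?C. dot_sign a p / 2 ^ n * G p (b + p))"
    using b by (intro sum.cong refl) (simp add: finite_bitstrings)
  \<comment> \<open>Replacing \<open>p\<close> by \<open>p + b\<close> turns the left factor into
    \<open>f (b + p)\<close>, which splits as \<open>f b * f p\<close>, and the right factor into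
    \<open>f p\<close>.\<close>
  also have "\<dots> = (\<Sum>p\<in>?C. dot_sign a (p + b) / 2 ^ n * G (p + b) (b + (p + b)))"
    by (rule sum.reindex_bij_betw[OF bij_betw_add_bitvec[OF b], symmetric])
  also have "\<dots> = (\<Sum>p\<in>?C. dot_sign a (b + p) / 2 ^ n * (f b * f p * F * f p) $$ (i, j))"
  proof (intro sum.cong refl)
    fix p assume p: "p \<in> ?C"
    have "p + b = b + p" using b p by (rule comm_add_vec[symmetric])
    then show "dot_sign a (p + b) / 2 ^ n * G (p + b) (b + (p + b)) =
      dot_sign a (b + p) / 2 ^ n * (f b * f p * F * f p) $$ (i, j)"
      using involutive_unitary_repD(4)[OF f b p] bitvec_add_cancel(2)[OF p b] by (simp add: G_def)
  qed
  also have "\<dots> = ?R $$ (i, j)"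
  proof -
    have "f b * f p * F * f p \<in> carrier_mat d d" if "p \<in> ?C" for p
      using Gc[of "b + p" p] b that by (simp add: involutive_unitary_repD(4)[OF f b that])
    from this[THEN carrier_matD(1)] this[THEN carrier_matD(2)] show ?thesis
      using i j by simp
  qed
  finally show "?L $$ (i, j) = ?R $$ (i, j)" .
qed simp_all

section \<open>The isometry and its compression of Pauli operators\<close>

definition pauli_frame :: "nat \<Rightarrow> nat \<Rightarrow> (bit vec \<Rightarrow> complex mat) \<Rightarrow> (bit vec \<Rightarrow> complex mat) \<Rightarrow> complex mat" where
  "pauli_frame n d f g = stack (2 ^ n) d (\<lambda>i. f (bitvec n i) * spectral_proj n d g (bitvec n i))"

text \<open>Blocks at \<open>y + a\<close> and \<open>y\<close> meet in
  \<open>f (y + a) * f y\<close>, which is \<open>f a\<close> by the group law. What remains is the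
  signed sum of sandwiches evaluated above.\<close>

lemma pauli_frame_compression:
  assumes f: "involutive_unitary_rep n d f" and g: "involutive_unitary_rep n d g"
    and a: "a \<in> carrier_vec n" and b: "b \<in> carrier_vec n"
  shows "mat_adjoint (pauli_frame n d f g) * ((pauli_X a * pauli_Z b) \<otimes>\<^sub>m 1\<^sub>m d) * pauli_frame n d f g =
    mat_sum d d (\<lambda>p. (dot_sign a (b + p) / 2 ^ n) \<cdot>\<^sub>m (g b * g p * f a * g p)) (carrier_vec n)"
proof -
  let ?C = "carrier_vec n :: bit vec set" and ?N = "{..<2 ^ n :: nat}"
  let ?P = "pauli_X a * pauli_Z b" and ?R = "spectral_proj n d g"
  define B where "B x = f x * ?R x" for x
  have fc: "f x \<in> carrier_mat d d" if "x \<in> ?C" for x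
    using that by (rule involutive_unitary_repD(1)[OF f])
  have Bc: "B x \<in> carrier_mat d d" if "x \<in> ?C" for x
    unfolding B_def using fc[OF that] spectral_proj_carrier by (rule mult_carrier_mat)
  have BB: "mat_adjoint (B x) * B y \<in> carrier_mat d d" if "x \<in> ?C" "y \<in> ?C" for x y
    using Bc[OF that(1)] Bc[OF that(2)] by (intro mult_carrier_mat) auto
  have zero_smult: "0 \<cdot>\<^sub>m M = 0\<^sub>m d d" if "M \<in> carrier_mat d d" for M :: "complex mat"
    using that by (intro eq_matI) auto
  have P: "?P \<in> carrier_mat (2 ^ n) (2 ^ n)"
    using pauli_string_carrier[of sigma_X a] pauli_string_carrier[of sigma_Z b] a b
    by (auto simp: pauli_X_def pauli_Z_def)
  have "mat_adjoint (pauli_frame n d f g) * (?P \<otimes>\<^sub>m 1\<^sub>m d) * pauli_frame n d f g =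
    mat_sum d d (\<lambda>j. mat_sum d d (\<lambda>i. ?P $$ (i, j) \<cdot>\<^sub>m (mat_adjoint (B (bitvec n i)) * B (bitvec n j))) ?N) ?N"
    unfolding pauli_frame_def B_def[symmetric] by (intro stack_sandwich P Bc) simp
  \<comment> \<open>Each column of the Pauli product has a single nonzero entry, in the row whose
    string is that of the column shifted by \<open>a\<close>; the inner sum reduces to it.\<close>
  also have "\<dots> = mat_sum d d (\<lambda>j. dot_sign (bitvec n j) b \<cdot>\<^sub>m
      (mat_adjoint (B (bitvec n j + a)) * B (bitvec n j))) ?N"
  proof (rule mat_sum_cong)
    fix j assume j: "j \<in> ?N"
    let ?y = "bitvec n j"
    have "mat_sum d d (\<lambda>i. ?P $$ (i, j) \<cdot>\<^sub>m (mat_adjoint (B (bitvec n i)) * B ?y)) ?N =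
      mat_sum d d (\<lambda>i. (of_bool (bitvec n i = ?y + a) * dot_sign ?y b) \<cdot>\<^sub>m
        (mat_adjoint (B (bitvec n i)) * B ?y)) ?N"
      using j a b by (intro mat_sum_cong) (simp add: pauli_XZ_index)
    also have "\<dots> = mat_sum d d (\<lambda>x. (of_bool (x = ?y + a) * dot_sign ?y b) \<cdot>\<^sub>m (mat_adjoint (B x) * B ?y)) ?C"
      by (rule mat_sum_reindex_bij_betw[OF bij_betw_bitvec])
    also have "\<dots> = (of_bool (?y + a = ?y + a) * dot_sign ?y b) \<cdot>\<^sub>m (mat_adjoint (B (?y + a)) * B ?y)"
      using a by (intro mat_sum_delta[where y = "?y + a"])
        (simp_all add: finite_bitstrings BB zero_smult[OF BB])
    finally show "mat_sum d d (\<lambda>i. ?P $$ (i, j) \<cdot>\<^sub>m (mat_adjoint (B (bitvec n i)) * B ?y)) ?N =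
      dot_sign ?y b \<cdot>\<^sub>m (mat_adjoint (B (?y + a)) * B ?y)" by simp
  qed
  also have "\<dots> = mat_sum d d (\<lambda>y. dot_sign y b \<cdot>\<^sub>m (mat_adjoint (B (y + a)) * B y)) ?C"
    by (rule mat_sum_reindex_bij_betw[OF bij_betw_bitvec])
  also have "\<dots> = mat_sum d d (\<lambda>y. dot_sign y b \<cdot>\<^sub>m (?R (y + a) * f a * ?R y)) ?C"
  proof (rule mat_sum_cong)
    fix y assume y: "y \<in> ?C"
    then have ya: "y + a \<in> ?C" using a by simp
    have "f (y + a) * f y = f a"
      using involutive_unitary_repD(4)[OF f ya y] bitvec_add_cancel(1)[OF a y] comm_add_vec[OF a y] by simp
    moreover have "mat_adjoint (B (y + a)) = ?R (y + a) * f (y + a)"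
      unfolding B_def using fc[OF ya]
      by (simp add: adjoint_mult[of _ d d _ d] adjoint_spectral_proj[OF g] involutive_unitary_repD(2)[OF f ya])
    ultimately have "mat_adjoint (B (y + a)) * B y = ?R (y + a) * f a * ?R y"
      using fc[OF ya] fc[OF y] fc[OF a]
      by (simp add: B_def assoc_mult_mat[of _ d d _ d _ d] flip: assoc_mult_mat[of "f (y + a)" d d "f y" d _ d])
    then show "dot_sign y b \<cdot>\<^sub>m (mat_adjoint (B (y + a)) * B y) = dot_sign y b \<cdot>\<^sub>m (?R (y + a) * f a * ?R y)"
      by simp
  qed
  also have "\<dots> = mat_sum d d (\<lambda>p. (dot_sign a (b + p) / 2 ^ n) \<cdot>\<^sub>m (g b * g p * f a * g p)) ?C"
    by (rule sum_sign_spectral_proj_sandwich[OF g fc[OF a] a b])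
  finally show ?thesis .
qed


text \<open>The case \<open>a = b = 0\<close> of the compression formula: the Pauli product is the
  identity, and each of the \<open>2 ^ n\<close> summands is the identity divided by
  \<open>2 ^ n\<close> because \<open>g p\<close> is an involution.\<close>

lemma pauli_frame_isometry:
  assumes f: "involutive_unitary_rep n d f" and g: "involutive_unitary_rep n d g"
  shows "isometry_mat d (2 ^ n * d) (pauli_frame n d f g)"
proof -
  let ?V = "pauli_frame n d f g" and ?C = "carrier_vec n :: bit vec set"
  have V: "?V \<in> carrier_mat (2 ^ n * d) d" by (simp add: pauli_frame_def stack_def)
  have P: "pauli_X (0\<^sub>v n) * pauli_Z (0\<^sub>v n) = 1\<^sub>m (2 ^ n)"
  proof (rule eq_matI)
    fix i j assume "i < dim_row (1\<^sub>m (2 ^ n) :: complex mat)" "j < dim_col (1\<^sub>m (2 ^ n) :: complex mat)"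
    then show "(pauli_X (0\<^sub>v n) * pauli_Z (0\<^sub>v n)) $$ (i, j) = (1\<^sub>m (2 ^ n) :: complex mat) $$ (i, j)"
      using bij_betw_imp_inj_on[OF bij_betw_bitvec, of n]
      by (auto simp: pauli_XZ_index[of _ n] inj_on_eq_iff)
  qed (use pauli_string_carrier[of sigma_X "0\<^sub>v n"] pauli_string_carrier[of sigma_Z "0\<^sub>v n"]
      in \<open>auto simp: pauli_X_def pauli_Z_def\<close>)
  have "mat_adjoint ?V * ?V = mat_adjoint ?V * ((pauli_X (0\<^sub>v n) * pauli_Z (0\<^sub>v n)) \<otimes>\<^sub>m 1\<^sub>m d) * ?V"
    using V by (simp add: P kron_one right_mult_one_mat[of _ d])
  also have "\<dots> = mat_sum d d (\<lambda>p. (1 / 2 ^ n) \<cdot>\<^sub>m (1\<^sub>m d :: complex mat)) ?C"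
    unfolding pauli_frame_compression[OF f g zero_carrier_vec zero_carrier_vec]
    using involutive_unitary_repD(1,3)[OF g]
    by (intro mat_sum_cong) (simp add: involutive_unitary_rep_zero[OF f] involutive_unitary_rep_zero[OF g]
        left_mult_one_mat[of _ d d] right_mult_one_mat[of _ d d])
  also have "\<dots> = 1\<^sub>m d"
    by (intro eq_matI) (auto simp: card_bitstrings)
  finally show ?thesis
    using V by (simp add: isometry_mat_def)
qed

subsection \<open>The error estimate\<close>

text \<open>The bound is pointwise in \<open>a\<close> and \<open>b\<close>. Its second term
  averages the defect \<open>h\<close> over all strings in place of \<open>b\<close>, which is what
  randomizing the first component produces under an expectation.\<close>

lemma pauli_frame_error:
  assumes \<sigma>: "psd_mat d \<sigma>"
    and f: "involutive_unitary_rep n d f" and g: "involutive_unitary_rep n d g"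
    and a: "a \<in> carrier_vec n" and b: "b \<in> carrier_vec n"
  defines "h \<equiv> \<lambda>c. state_norm_sq \<sigma> (g c * f a - dot_sign a c \<cdot>\<^sub>m (f a * g c))"
  shows "state_norm_sq \<sigma> (f a * g b -
      mat_adjoint (pauli_frame n d f g) * ((pauli_X a * pauli_Z b) \<otimes>\<^sub>m 1\<^sub>m d) * pauli_frame n d f g)
    \<le> 2 * h b + 2 * ((\<Sum>c\<in>carrier_vec n. h c) / 2 ^ n)"
proof -
  let ?C = "carrier_vec n :: bit vec set"
  let ?M = "dot_sign a b \<cdot>\<^sub>m (g b * f a)"
  define T where "T p = g b * g p * f a * g p" for p
  define W where "W = mat_sum d d (\<lambda>p. (dot_sign a (b + p) / 2 ^ n) \<cdot>\<^sub>m T p) ?C"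
  define D where "D p = g p * f a - dot_sign a p \<cdot>\<^sub>m (f a * g p)" for p
  have sc: "\<sigma> \<in> carrier_mat d d" using \<sigma> by (simp add: psd_mat_def)
  have fa: "f a \<in> carrier_mat d d" using involutive_unitary_repD(1)[OF f a] .
  have gc: "g p \<in> carrier_mat d d" if "p \<in> ?C" for p using involutive_unitary_repD(1)[OF g that] .
  have fg: "f a * g p \<in> carrier_mat d d" and gf: "g p * f a \<in> carrier_mat d d"
    if "p \<in> ?C" for p
    using fa gc[OF that] by auto
  have Dc: "D p \<in> carrier_mat d d" if "p \<in> ?C" for p
    unfolding D_def using fg[OF that] by (intro minus_carrier_mat smult_carrier_mat)
  have Mc: "?M \<in> carrier_mat d d" using gf[OF b] by simp
  have Wc: "W \<in> carrier_mat d d" by (simp add: W_def)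
  \<comment> \<open>Since \<open>s\<close> squares to 1, exchanging the two products costs only the
    factor \<open>- s\<close>.\<close>
  have swap_minus: "A - s \<cdot>\<^sub>m B = (- s) \<cdot>\<^sub>m (B - s \<cdot>\<^sub>m A)"
    if "A \<in> carrier_mat d d" "B \<in> carrier_mat d d" "s = 1 \<or> s = -1" for A B :: "complex mat" and s
    using that by (intro eq_matI) auto
  have first: "state_norm_sq \<sigma> (f a * g b - ?M) = h b"
  proof -
    have "f a * g b - ?M = (- dot_sign a b) \<cdot>\<^sub>m D b"
      using swap_minus[OF fg[OF b] gf[OF b] dot_sign_cases] by (simp add: D_def)
    then have "state_norm_sq \<sigma> (f a * g b - ?M) = (cmod (- dot_sign a b))\<^sup>2 * state_norm_sq \<sigma> (D b)"
      by (simp only: state_norm_sq_smult[OF sc Dc[OF b]])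
    then show ?thesis
      using dot_sign_cases[of a b] by (auto simp: h_def D_def)
  qed
  \<comment> \<open>Left multiplication of the defect \<open>D p\<close> by \<open>g (b + p)\<close>
    gives \<open>g b * f a\<close> in the first term and \<open>T p\<close> in the second, up to
    sign; the sign at \<open>b + p\<close> splits into those at \<open>b\<close> and
    \<open>p\<close>.\<close>
  have summand: "(1 / 2 ^ n) \<cdot>\<^sub>m ?M - (dot_sign a (b + p) / 2 ^ n) \<cdot>\<^sub>m T p =
      (dot_sign a b / 2 ^ n) \<cdot>\<^sub>m (g (b + p) * D p)" if p: "p \<in> ?C" for p
  proof -
    have bp: "b + p \<in> ?C" using b p by simp
    have "g (b + p) * (g p * f a) = g b * f a"
      using assoc_mult_mat[OF gc[OF bp] gc[OF p] fa] involutive_unitary_repD(4)[OF g bp p]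
        bitvec_add_cancel(1)[OF b p] by simp
    moreover have "g (b + p) * (f a * g p) = T p"
      using assoc_mult_mat[OF gc[OF bp] fa gc[OF p]] involutive_unitary_repD(4)[OF g b p]
      by (simp add: T_def)
    ultimately have "g (b + p) * D p = g b * f a - dot_sign a p \<cdot>\<^sub>m T p"
      unfolding D_def using gf[OF p] fg[OF p] gc[OF bp]
      by (simp add: mult_minus_distrib_mat[of _ d d _ d] mult_smult_distrib[of _ d d _ d])
    moreover have "T p \<in> carrier_mat d d"
      unfolding T_def using gc[OF b] gc[OF p] fa by (intro mult_carrier_mat)
    ultimately show ?thesis
      using gc[OF b] fa dot_sign_add_right[OF a b p]
      by (intro eq_matI) (auto simp: algebra_simps diff_divide_distrib smult_smult_mat)
  qed
  have Ec: "g (b + p) * D p \<in> carrier_mat d d" if p: "p \<in> ?C" for p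
    using gc[of "b + p"] Dc[OF p] b p by (intro mult_carrier_mat) auto
  \<comment> \<open>Writing \<open>?M\<close> as an average of equal copies allows a termwise
    comparison with \<open>W\<close>.\<close>
  have "?M = mat_sum d d (\<lambda>p. (1 / 2 ^ n) \<cdot>\<^sub>m ?M) ?C"
    using mat_sum_smult_const[OF Mc, of "\<lambda>_. 1 / 2 ^ n" ?C] by (simp add: card_bitstrings smult_smult_mat)
  then have "?M - W = mat_sum d d (\<lambda>p. (1 / 2 ^ n) \<cdot>\<^sub>m ?M) ?C - W" by simp
  also have "\<dots> = mat_sum d d (\<lambda>p. (1 / 2 ^ n) \<cdot>\<^sub>m ?M - (dot_sign a (b + p) / 2 ^ n) \<cdot>\<^sub>m T p) ?C"
    unfolding W_def T_def using Mc gc[OF b] gc fa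
    by (intro mat_sum_minus[symmetric] smult_carrier_mat mult_carrier_mat)
  also have "\<dots> = mat_sum d d (\<lambda>p. (dot_sign a b / 2 ^ n) \<cdot>\<^sub>m (g (b + p) * D p)) ?C"
    by (intro mat_sum_cong summand)
  finally have "state_norm_sq \<sigma> (?M - W) \<le>
      card ?C * (\<Sum>p\<in>?C. state_norm_sq \<sigma> ((dot_sign a b / 2 ^ n) \<cdot>\<^sub>m (g (b + p) * D p)))"
    using state_norm_sq_mat_sum_le[OF \<sigma> finite_bitstrings, of n
        "\<lambda>p. (dot_sign a b / 2 ^ n) \<cdot>\<^sub>m (g (b + p) * D p)" d] Ec by simp
  also have "(\<Sum>p\<in>?C. state_norm_sq \<sigma> ((dot_sign a b / 2 ^ n) \<cdot>\<^sub>m (g (b + p) * D p))) =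
      (\<Sum>p\<in>?C. h p / (2 ^ n * 2 ^ n))"
  \<comment> \<open>The unitary \<open>g (b + p)\<close> drops out of the seminorm, and the scalar
    contributes the square of its modulus.\<close>
  proof (intro sum.cong refl)
    fix p assume p: "p \<in> ?C"
    have bp: "b + p \<in> ?C" using b p by simp
    have "state_norm_sq \<sigma> (g (b + p) * D p) = h p"
      using state_norm_sq_isometry_mult[OF gc[OF bp] _ Dc[OF p]]
        involutive_unitary_repD(2,3)[OF g bp] by (simp add: h_def D_def)
    moreover have "cmod (dot_sign a b / 2 ^ n) = 1 / 2 ^ n"
      using dot_sign_cases[of a b] by (auto simp: norm_divide norm_power)
    ultimately show "state_norm_sq \<sigma> ((dot_sign a b / 2 ^ n) \<cdot>\<^sub>m (g (b + p) * D p)) = h p / (2 ^ n * 2 ^ n)"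
      by (simp add: state_norm_sq_smult[OF sc Ec[OF p]] power2_eq_square)
  qed
  \<comment> \<open>The cardinality cancels one of the two factors \<open>2 ^ n\<close>, leaving a
    uniform average.\<close>
  also have "card ?C * (\<Sum>p\<in>?C. h p / (2 ^ n * 2 ^ n)) = (\<Sum>p\<in>?C. h p) / 2 ^ n"
    by (simp add: card_bitstrings sum_distrib_left sum_divide_distrib)
  finally have "state_norm_sq \<sigma> (?M - W) \<le> (\<Sum>p\<in>?C. h p) / 2 ^ n" .
  then have "state_norm_sq \<sigma> (f a * g b - W) \<le> 2 * h b + 2 * ((\<Sum>p\<in>?C. h p) / 2 ^ n)"
    using state_norm_sq_diff_triangle[OF \<sigma> fg[OF b] Mc Wc] first by linarith
  then show ?thesis
    unfolding pauli_frame_compression[OF f g a b] W_def T_def .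
qed

text \<open>Translation by a fixed \<open>b\<close> permutes the strings, so \<open>b + r\<close> is
  uniform whatever \<open>b\<close> is. Finite support turns both expectations into finite
  sums.\<close>

lemma expectation_randomize_fst:
  fixes h :: "bit vec \<times> bit vec \<Rightarrow> real"
  assumes \<mu>: "set_pmf \<mu> \<subseteq> carrier_vec n \<times> carrier_vec n"
  shows "measure_pmf.expectation (randomize_fst n \<mu>) h =
    measure_pmf.expectation \<mu> (\<lambda>(b, a). (\<Sum>c\<in>carrier_vec n. h (c, a)) / 2 ^ n)"
proof -
  let ?C = "carrier_vec n :: bit vec set"
  let ?u = "pmf_of_set ?C"
  have ne: "?C \<noteq> {}" using zero_carrier_vec[of n] by blast
  have u: "pmf ?u r = 1 / 2 ^ n" if "r \<in> ?C" for r
    using that ne by (simp add: pmf_of_set finite_bitstrings card_bitstrings)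
  have "measure_pmf.expectation (randomize_fst n \<mu>) h =
      measure_pmf.expectation (pair_pmf \<mu> ?u) (\<lambda>z. h (fst (fst z) + snd z, snd (fst z)))"
    by (simp add: randomize_fst_def split_def)
  also have "\<dots> = (\<Sum>x\<in>(?C \<times> ?C) \<times> ?C. h (fst (fst x) + snd x, snd (fst x)) * pmf (pair_pmf \<mu> ?u) x)"
    using \<mu> ne by (subst integral_measure_pmf_real[where A = "(?C \<times> ?C) \<times> ?C"]) (auto simp: finite_bitstrings)
  also have "\<dots> = (\<Sum>z\<in>?C \<times> ?C. \<Sum>r\<in>?C. h (fst z + r, snd z) * (pmf \<mu> z * (1 / 2 ^ n)))"
    by (subst sum.cartesian_product', intro sum.cong refl) (auto simp: pmf_pair u split_def)
  also have "\<dots> = (\<Sum>z\<in>?C \<times> ?C. (case z of (b, a) \<Rightarrow> (\<Sum>c\<in>?C. h (c, a)) / 2 ^ n) * pmf \<mu> z)"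
  proof (intro sum.cong refl, clarify)
    fix b a assume b: "b \<in> ?C"
    have "(\<Sum>r\<in>?C. h (b + r, a)) = (\<Sum>r\<in>?C. h (r + b, a))"
      using b by (intro sum.cong refl) (simp add: comm_add_vec[of _ n])
    also have "\<dots> = (\<Sum>c\<in>?C. h (c, a))"
      by (rule sum.reindex_bij_betw[OF bij_betw_add_bitvec[OF b], of "\<lambda>c. h (c, a)"])
    finally show "(\<Sum>r\<in>?C. h (fst (b, a) + r, snd (b, a)) * (pmf \<mu> (b, a) * (1 / 2 ^ n))) =
        (\<Sum>c\<in>?C. h (c, a)) / 2 ^ n * pmf \<mu> (b, a)"
      by (simp flip: sum_distrib_right sum_divide_distrib)
  qed
  also have "\<dots> = measure_pmf.expectation \<mu> (\<lambda>(b, a). (\<Sum>c\<in>?C. h (c, a)) / 2 ^ n)"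
    using \<mu> by (intro integral_measure_pmf_real[symmetric]) (auto simp: finite_bitstrings)
  finally show ?thesis .
qed

theorem theorem4p23:
  shows "\<exists>C :: real. \<forall>(n :: nat) (d :: nat) (\<delta> :: real) (\<sigma> :: complex mat)
      (\<mu>\<^sub>1 :: (bit vec \<times> bit vec) pmf) (f\<^sub>X :: bit vec \<Rightarrow> complex mat) (f\<^sub>Z :: bit vec \<Rightarrow> complex mat).
    n > 0 \<longrightarrow> d > 0 \<longrightarrow> 0 < \<delta> \<longrightarrow> \<delta> < 1 \<longrightarrow>
    psd_mat d \<sigma> \<longrightarrow> mat_trace \<sigma> = 1 \<longrightarrow>
    set_pmf \<mu>\<^sub>1 \<subseteq> carrier_vec n \<times> carrier_vec n \<longrightarrow>
    involutive_unitary_rep n d f\<^sub>X \<longrightarrow> involutive_unitary_rep n d f\<^sub>Z \<longrightarrow>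
    (\<forall>\<mu> \<in> {\<mu>\<^sub>1, randomize_fst n \<mu>\<^sub>1}.
      measure_pmf.expectation \<mu> (\<lambda>(b, a).
        state_norm_sq \<sigma> (f\<^sub>Z b * f\<^sub>X a - dot_sign a b \<cdot>\<^sub>m (f\<^sub>X a * f\<^sub>Z b))) \<le> \<delta>) \<longrightarrow>
    (\<exists>d'' V. d'' > 0 \<and> isometry_mat d (2 ^ n * d'') V \<and>
      measure_pmf.expectation \<mu>\<^sub>1 (\<lambda>(b, a).
        state_norm_sq \<sigma>
          (f\<^sub>X a * f\<^sub>Z b - mat_adjoint V * ((pauli_X a * pauli_Z b) \<otimes>\<^sub>m 1\<^sub>m d'') * V)) \<le> C * \<delta>)"
proof (intro exI[of _ "4 :: real"] allI impI, goal_cases)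
  case (1 n d \<delta> \<sigma> \<mu> f g)
  let ?C = "carrier_vec n :: bit vec set" and ?V = "pauli_frame n d f g"
  define h where "h = (\<lambda>(b, a). state_norm_sq \<sigma> (g b * f a - dot_sign a b \<cdot>\<^sub>m (f a * g b)))"
  \<comment> \<open>The expectation of \<open>h'\<close> under the original distribution is that of
    \<open>h\<close> under the randomized one.\<close>
  define h' where "h' = (\<lambda>(b :: bit vec, a). (\<Sum>c\<in>?C. h (c, a)) / 2 ^ n)"
  define e where "e = (\<lambda>(b, a). state_norm_sq \<sigma>
    (f a * g b - mat_adjoint ?V * ((pauli_X a * pauli_Z b) \<otimes>\<^sub>m 1\<^sub>m d) * ?V))"
  have "finite (?C \<times> ?C)" by (simp add: finite_bitstrings)
  \<comment> \<open>The support lies in a finite set, so every real function is integrable.\<close>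
  then have int: "integrable (measure_pmf \<mu>) k" for k :: "_ \<Rightarrow> real"
    using 1(7) by (intro integrable_measure_pmf_finite finite_subset[OF 1(7)])
  have "e z \<le> 2 * h z + 2 * h' z" if "z \<in> set_pmf \<mu>" for z
    using that 1(7) pauli_frame_error[OF 1(5,8,9), of "snd z" "fst z"]
    by (auto simp: e_def h_def h'_def)
  then have "measure_pmf.expectation \<mu> e \<le> measure_pmf.expectation \<mu> (\<lambda>z. 2 * h z + 2 * h' z)"
    by (intro integral_mono_AE int) (simp add: AE_measure_pmf_iff)
  also have "\<dots> = 2 * measure_pmf.expectation \<mu> h + 2 * measure_pmf.expectation (randomize_fst n \<mu>) h"
    by (simp add: int expectation_randomize_fst[OF 1(7)] h'_def)
  \<comment> \<open>Each expectation of the defect is at most \<open>\<delta>\<close>, one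
    hypothesis for each distribution, and the two coefficients 2 add up to the constant.\<close>
  also have "\<dots> \<le> 4 * \<delta>"
    using 1(10) by (simp add: h_def)
  finally show ?case
    \<comment> \<open>The auxiliary dimension is \<open>d\<close> itself.\<close>
    using 1(2) pauli_frame_isometry[OF 1(8,9)] unfolding e_def by blast
qed

end
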